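(* Let $p$ be an odd prime, let $k$ be an integer with $1\le k<p/2$, and let $l\ge 1$ be an integer. Let $\alpha=[a_1,a_2,\dots,a_n,\dots]\in\mathbb{F}_p((T^{-1}))$ be a $P_k$-expansion of first kind defined by an $(l+2)$-tuple $(a_1,\dots,a_l,\epsilon_1,\epsilon_2)$, and suppose it is perfect with the following pattern: there is a sequence $(\lambda_n)_{n\ge1}$ in $\mathbb{F}_p^*$ such that $a_n=\lambda_nA_{i(n)}$ for all $n\ge 1$, where $(i(n))_{n\ge1}$ is the sequence of letters of the infinite word $$V_0^{[l]},V_1^{[l]},V_2^{[l]},\dots,V_n^{[l]},\dots$$ and the finite words $V_n$ of non-negative integers are defined by $V_0=0$ and $V_n=n,V_0^{[2k]},V_1^{[2k]},\dots,V_{n-1}^{[2k]}$ for $n\ge1$. Then the irrationality measure of $\alpha$ is $$\nu(\alpha)=2+\frac{p-2k-1}{l}.$$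
   Context: $\mathbb{F}_p((T^{-1}))$ is the field of power series in $1/T$ over $\mathbb{F}_p$, with the ultrametric absolute value $|\sum_{i\le i_0}u_iT^i|=|T|^{i_0}$ if $u_{i_0}\ne0$, where $|T|>1$ is a fixed real number. Every irrational element $\alpha$ with $|\alpha|>1$ has a unique infinite continued fraction expansion $\alpha=[a_1,a_2,\dots]$ with $a_i\in\mathbb{F}_p[T]$ non-constant; $\alpha_{n+1}=[a_{n+1},a_{n+2},\dots]$ denotes its tail. The irrationality measure of an irrational $\alpha$ is $\nu(\alpha)=\limsup_{|Q|\to\infty}\bigl(-\log|\alpha-P/Q|/\log|Q|\bigr)$, over $P,Q\in\mathbb{F}_p[T]$, $Q\neq 0$. Set $P_k=(T^2-1)^k\in\mathbb{F}_p[T]$ and $Q_k=\int_0^T(x^2-1)^{k-1}dx=\sum_{0\le i\le k-1}(-1)^{k-1-i}\binom{k-1}{i}(2i+1)^{-1}T^{2i+1}\in\mathbb{F}_p[T]$. The polynomials $A_n\in\mathbb{F}_p[T]$ are defined by $A_0=T$ and $A_{n+1}=[A_n^p/P_k]$ for $n\ge 0$, where here the bracket denotes the polynomial part of a rational function. A $P_k$-expansion of first kind defined by $(a_1,\dots,a_l,\epsilon_1,\epsilon_2)$, where the $a_i\in\mathbb{F}_p[T]$ are non-constant and $\epsilon_1,\epsilon_2\in\mathbb{F}_p^*$, is the (unique) infinite continued fraction $\alpha$ with $|\alpha|>1$ whose first $l$ partial quotients are $a_1,\dots,a_l$ and which satisfies $\alpha^p=\epsilon_1P_k\alpha_{l+1}+\epsilon_2Q_k$.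 Words are finite or infinite sequences; commas denote concatenation, and $W^{[n]}$ denotes the word $W$ repeated $n$ times ($W^{[0]}$ is empty). *)

theory Defs
  imports
    Complex_Main
    "HOL-Library.Extended_Real"
    "HOL-Library.Liminf_Limsup"
    "HOL-Library.Stream"
    "HOL-Computational_Algebra.Formal_Laurent_Series"
    "Berlekamp_Zassenhaus.Finite_Field"
begin

text \<open>
  The field \<open>K((1/T))\<close> is the library type \<open>'a fls\<close> with the formal variable read as \<open>1/T\<close>,
  so that \<open>T\<close> is \<^const>\<open>fls_X_inv\<close> and the degree in \<open>T\<close> is the negated \<^const>\<open>fls_subdegree\<close>.
  The parameter \<open>b\<close> is the fixed real number \<open>\<bar>T\<bar> > 1\<close>.
\<close>

definition poly_to_fls :: "'a::field poly \<Rightarrow> 'a fls" where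
  "poly_to_fls q = poly (map_poly fls_const q) fls_X_inv"

definition ultra_abs :: "real \<Rightarrow> 'a::field fls \<Rightarrow> real" where
  "ultra_abs b f = (if f = 0 then 0 else b powi (- fls_subdegree f))"

text \<open>
  The limit superior over pairs \<open>(P, Q)\<close> of polynomials, \<open>P\<close> arbitrary, as \<open>\<bar>Q\<bar>\<close> tends to infinity
  (which forces \<open>Q \<noteq> 0\<close>).  Only meaningful for irrational \<open>\<alpha>\<close>, as \<^term>\<open>ln 0 = (0::real)\<close>.
\<close>

definition irrationality_measure :: "real \<Rightarrow> 'a::field fls \<Rightarrow> ereal" where
  "irrationality_measure b \<alpha> =
     Limsup (filtercomap (\<lambda>(P :: 'a poly, Q :: 'a poly). ultra_abs b (poly_to_fls Q)) at_top)
       (\<lambda>(P, Q). ereal (- ln (ultra_abs b (\<alpha> - poly_to_fls P / poly_to_fls Q))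
                        / ln (ultra_abs b (poly_to_fls Q))))"

fun finite_cfrac :: "'a::field poly list \<Rightarrow> 'a fls" where
  "finite_cfrac [] = 0"
| "finite_cfrac [q] = poly_to_fls q"
| "finite_cfrac (q # r # qs) = poly_to_fls q + 1 / finite_cfrac (r # qs)"

text \<open>
  \<open>\<alpha> = [a 1, a 2, \<dots>]\<close> with all partial quotients non-constant; the entry \<open>a 0\<close> is not used.
  The limit is taken in the library topology of \<open>'a fls\<close>, which is the one induced by
  \<^const>\<open>ultra_abs\<close> for any \<open>b > 1\<close>.  Such an \<open>\<alpha>\<close> is irrational with \<open>\<bar>\<alpha>\<bar> = \<bar>a 1\<bar> > 1\<close>.
\<close>

definition has_cfrac :: "'a::field fls \<Rightarrow> (nat \<Rightarrow> 'a poly) \<Rightarrow> bool" where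
  "has_cfrac \<alpha> a \<longleftrightarrow> (\<forall>n\<ge>1. degree (a n) > 0) \<and>
     (\<lambda>n. finite_cfrac (map a [1..<Suc n])) \<longlonglongrightarrow> \<alpha>"

definition P_poly :: "nat \<Rightarrow> 'a::field poly" where
  "P_poly k = ([:0, 1:] ^ 2 - 1) ^ k"

definition Q_poly :: "nat \<Rightarrow> 'a::field poly" where
  "Q_poly k = (\<Sum>i = 0..k - 1.
     Polynomial.monom ((-1) ^ (k - 1 - i) * of_nat ((k - 1) choose i) * inverse (of_nat (2 * i + 1))) (2 * i + 1))"

text \<open>The polynomial part of a rational function is the quotient of the Euclidean division.\<close>

fun A_poly :: "nat \<Rightarrow> nat \<Rightarrow> nat \<Rightarrow> 'a::field poly" where
  "A_poly p k 0 = [:0, 1:]"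
| "A_poly p k (Suc n) = A_poly p k n ^ p div P_poly k"

text \<open>
  \<open>\<alpha>\<close> is the \<open>P\<^sub>k\<close>-expansion of first kind defined by the list \<open>as\<close> of its first partial quotients
  and by \<open>\<epsilon>1\<close>, \<open>\<epsilon>2\<close>; here \<open>\<beta>\<close> is the tail of \<open>\<alpha>\<close> that starts after these partial quotients.
\<close>

definition first_kind_expansion ::
  "nat \<Rightarrow> nat \<Rightarrow> 'a::field poly list \<Rightarrow> 'a \<Rightarrow> 'a \<Rightarrow> 'a fls \<Rightarrow> bool" where
  "first_kind_expansion p k as \<epsilon>1 \<epsilon>2 \<alpha> \<longleftrightarrow>
     (\<forall>q\<in>set as. degree q > 0) \<and> \<epsilon>1 \<noteq> 0 \<and> \<epsilon>2 \<noteq> 0 \<and>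
     (\<exists>a \<beta>. has_cfrac \<alpha> a \<and> map a [1..<Suc (length as)] = as \<and>
            has_cfrac \<beta> (\<lambda>n. a (length as + n)) \<and>
            \<alpha> ^ p = fls_const \<epsilon>1 * poly_to_fls (P_poly k) * \<beta>
                     + fls_const \<epsilon>2 * poly_to_fls (Q_poly k))"

definition word_power :: "'b list \<Rightarrow> nat \<Rightarrow> 'b list" where
  "word_power w n = concat (replicate n w)"

fun V_word :: "nat \<Rightarrow> nat \<Rightarrow> nat list" where
  "V_word k 0 = [0]"
| "V_word k (Suc n) = Suc n # concat (map (\<lambda>j. word_power (V_word k j) (2 * k)) [0..<Suc n])"

text \<open>
  The infinite word \<open>V\<^sub>0\<^sup>[\<^sup>l\<^sup>], V\<^sub>1\<^sup>[\<^sup>l\<^sup>], \<dots>\<close> (for \<open>l \<ge> 1\<close>, since \<^const>\<open>flat\<close> expects non-empty blocks)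
  and its letters \<open>i(n)\<close>, numbered from \<open>n = 1\<close> whereas streams are indexed from 0.
\<close>

definition pattern_word :: "nat \<Rightarrow> nat \<Rightarrow> nat stream" where
  "pattern_word k l = flat (smap (\<lambda>j. word_power (V_word k j) l) nats)"

definition pattern_index :: "nat \<Rightarrow> nat \<Rightarrow> nat \<Rightarrow> nat" where
  "pattern_index k l n = pattern_word k l !! (n - 1)"

end

theory Submission
  imports Defs
begin

text \<open>
  Let \<open>D\<^sub>n\<close> be the degree of the denominator of the \<open>n\<close>-th convergent, that is the sum of the degrees
  of the partial quotients \<open>a\<^sub>2, \<dots>, a\<^sub>n\<close>.  Since the convergents have approximation order
  \<open>D\<^sub>n + D\<^sub>n\<^sub>+\<^sub>1 = 2 D\<^sub>n + deg a\<^sub>n\<^sub>+\<^sub>1\<close> and any other fraction does no better than exponent 2, the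
  irrationality measure exceeds 2 by \<open>limsup deg a\<^sub>n\<^sub>+\<^sub>1 / D\<^sub>n\<close>.  For the pattern at hand put
  \<open>T\<^sub>m = 1 + p + \<dots> + p\<^sup>m\<^sup>-\<^sup>1\<close> and \<open>r = p - 2k - 1\<close>.  Then \<open>deg A\<^sub>m = 1 + r T\<^sub>m\<close> and the word \<open>V\<^sub>m\<close> has
  total degree \<open>p\<^sup>m\<close>.  The letter \<open>m\<close> cannot occur before the block \<open>V\<^sub>m\<^sup>[\<^sup>l\<^sup>]\<close>, at whose start the
  total degree is \<open>l T\<^sub>m\<close>; hence \<open>deg a\<^sub>n\<^sub>+\<^sub>1 \<le> 1 + (r / l) (D\<^sub>n + 1)\<close>, with equality at the start of
  each block.
\<close>

subsection \<open>The embedding of polynomials into Laurent series\<close>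

lemma map_poly_fls_const_hom: "map_poly_comm_ring_hom (fls_const :: 'a::comm_ring_1 \<Rightarrow> 'a fls)"
  by unfold_locales (auto intro: fls_eqI)

interpretation poly_to_fls: comm_ring_hom "poly_to_fls :: 'a::field poly \<Rightarrow> 'a fls"
proof -
  interpret h: map_poly_comm_ring_hom "fls_const :: 'a \<Rightarrow> 'a fls"
    by (rule map_poly_fls_const_hom)
  show "comm_ring_hom (poly_to_fls :: 'a poly \<Rightarrow> 'a fls)"
    by unfold_locales (simp_all add: poly_to_fls_def h.hom_add h.hom_mult)
qed

lemma poly_to_fls_pCons:
  "poly_to_fls (pCons c q) = fls_const c + fls_X_inv * poly_to_fls (q :: 'a::field poly)"
  by (simp add: poly_to_fls_def Polynomial.map_poly_pCons)

text \<open>In the Horner form \<open>c + T * q\<close> the second summand has negative subdegree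
  and dominates the constant. Both claims share one induction because subdegrees add only for
  nonzero factors.\<close>

lemma poly_to_fls_nonzero_and_subdegree:
  fixes q :: "'a::field poly"
  assumes "q \<noteq> 0"
  shows "poly_to_fls q \<noteq> 0 \<and> fls_subdegree (poly_to_fls q) = - int (degree q)"
  using assms
proof (induction q)
  case 0
  then show ?case by simp
next
  case (pCons c q)
  show ?case
  proof (cases "q = 0")
    case True
    with pCons show ?thesis by (simp add: poly_to_fls_pCons)
  next
    case False
    have nz: "fls_X_inv * poly_to_fls q \<noteq> 0"
      using pCons False by simp
    have sd: "fls_subdegree (fls_X_inv * poly_to_fls q) = - 1 - int (degree q)"
      using pCons False by simp
    have "fls_subdegree (poly_to_fls (pCons c q)) = - 1 - int (degree q)"
      unfolding poly_to_fls_pCons using fls_subdegree_add_eq2 [OF nz, of "fls_const c"] sd by simp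
    \<comment> \<open>The zero series has subdegree 0 by convention, so a negative subdegree rules
      it out.\<close>
    moreover from this have "poly_to_fls (pCons c q) \<noteq> 0"
      by force
    ultimately show ?thesis using False by simp
  qed
qed

lemma poly_to_fls_eq_0_iff [simp]: "poly_to_fls q = 0 \<longleftrightarrow> q = (0 :: 'a::field poly)"
  using poly_to_fls_nonzero_and_subdegree by auto

lemma fls_subdegree_poly_to_fls [simp]:
  "fls_subdegree (poly_to_fls (q :: 'a::field poly)) = - int (degree q)"
  using poly_to_fls_nonzero_and_subdegree by (cases "q = 0") auto

section \<open>Absolute values, exponents and distances in terms of subdegrees\<close>

lemma ultra_abs_poly_to_fls:
  "q \<noteq> 0 \<Longrightarrow> ultra_abs b (poly_to_fls (q :: 'a::field poly)) = b ^ degree q"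
  by (simp add: ultra_abs_def)

lemma ln_ultra_abs:
  "b > 1 \<Longrightarrow> f \<noteq> 0 \<Longrightarrow> ln (ultra_abs b f) = - of_int (fls_subdegree f) * ln b"
  by (simp add: ultra_abs_def ln_powr flip: powr_real_of_int')

text \<open>The factor \<open>ln b\<close> cancels, so the exponent does not depend on the choice of
  |T|.\<close>

lemma approximation_exponent_eq:
  fixes P Q :: "'a::field poly"
  assumes "b > 1" "Q \<noteq> 0" "\<alpha> - poly_to_fls P / poly_to_fls Q \<noteq> 0"
  shows "- ln (ultra_abs b (\<alpha> - poly_to_fls P / poly_to_fls Q)) / ln (ultra_abs b (poly_to_fls Q)) =
    of_int (fls_subdegree (\<alpha> - poly_to_fls P / poly_to_fls Q)) / real (degree Q)"
  using assms by (simp add: ln_ultra_abs)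

lemma lt_subdegree_of_dist_lt:
  assumes "dist f g < inverse (2 ^ N)"
  shows "g = f \<or> fls_subdegree (g - f) > int N"
proof (rule ccontr)
  assume neg: "\<not> ?thesis"
  let ?v = "fls_subdegree (f - g)"
  have ne: "f \<noteq> g" and v: "?v \<le> int N"
    using neg fls_subdegree_minus_sym [of f g] by auto
  have "inverse (2 ^ N) \<le> dist f g"
  proof (cases "?v \<ge> 0")
    case True
    have "(2::real) ^ nat ?v \<le> 2 ^ N"
      using v by (intro power_increasing) auto
    with True ne show ?thesis by (simp add: dist_fls_def le_imp_inverse_le)
  next
    case False
    have "inverse (2 ^ N) \<le> (1::real)" by (simp add: inverse_le_1_iff)
    also have "1 \<le> (2::real) ^ nat (- ?v)" by simp
    finally show ?thesis using False ne by (simp add: dist_fls_def)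
  qed
  with assms show False by simp
qed

subsection \<open>Continuants and convergents\<close>

text \<open>Numerators and denominators of the convergents obey the same recurrence and differ only
  in the initial values \<open>x\<close>, \<open>y\<close>. Index 0 is the formal convergent 1/0;
  genuine convergents start at index 1.\<close>

fun continuant :: "'a::semiring_1 \<Rightarrow> 'a \<Rightarrow> (nat \<Rightarrow> 'a) \<Rightarrow> nat \<Rightarrow> 'a" where
  "continuant x y a 0 = x"
| "continuant x y a (Suc 0) = y"
| "continuant x y a (Suc (Suc n)) = a (Suc (Suc n)) * continuant x y a (Suc n) + continuant x y a n"

abbreviation cf_num :: "(nat \<Rightarrow> 'a::semiring_1) \<Rightarrow> nat \<Rightarrow> 'a" where
  "cf_num a \<equiv> continuant 1 (a 1) a"

abbreviation cf_den :: "(nat \<Rightarrow> 'a::semiring_1) \<Rightarrow> nat \<Rightarrow> 'a" where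
  "cf_den a \<equiv> continuant 0 1 a"

lemma continuant_determinant:
  fixes a :: "nat \<Rightarrow> 'a::comm_ring_1"
  shows "cf_num a (Suc n) * cf_den a n - cf_num a n * cf_den a (Suc n) = (-1) ^ Suc n"
proof (induction n)
  case (Suc n)
  have "cf_num a (Suc (Suc n)) * cf_den a (Suc n) - cf_num a (Suc n) * cf_den a (Suc (Suc n))
      = - (cf_num a (Suc n) * cf_den a n - cf_num a n * cf_den a (Suc n))"
    by (simp add: algebra_simps)
  with Suc show ?case by simp
qed simp

lemma finite_cfrac_snoc:
  "finite_cfrac (qs @ [q]) = foldr (\<lambda>q z. poly_to_fls q + 1 / z) qs (poly_to_fls q)"
proof (induction qs)
  case (Cons r qs)
  then show ?case by (cases qs) simp_all
qed simp

text \<open>The last entry is generalised to any series \<open>y\<close> of absolute value above 1,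
  so that the induction can absorb the last partial quotient: a + 1/y is again of this kind, in
  particular nonzero.\<close>

lemma foldr_cfrac_continuant:
  fixes a :: "nat \<Rightarrow> 'a::field poly"
  assumes "\<And>n. n \<ge> 1 \<Longrightarrow> degree (a n) > 0" and "fls_subdegree y < 0"
  shows "foldr (\<lambda>q z. poly_to_fls q + 1 / z) (map a [1..<Suc (Suc n)]) y =
    (poly_to_fls (cf_num a (Suc n)) * y + poly_to_fls (cf_num a n)) /
    (poly_to_fls (cf_den a (Suc n)) * y + poly_to_fls (cf_den a n))"
  using assms(2)
proof (induction n arbitrary: y)
  case 0
  then have "y \<noteq> 0" by auto
  then show ?case by (simp add: field_simps)
next
  case (Suc n)
  let ?P = "\<lambda>n. poly_to_fls (cf_num a n)" and ?Q = "\<lambda>n. poly_to_fls (cf_den a n)"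
  let ?a = "poly_to_fls (a (Suc (Suc n)))"
  let ?z = "?a + 1 / y"
  have y: "y \<noteq> 0" using Suc.prems by auto
  have deg: "degree (a (Suc (Suc n))) > 0" using assms(1) by simp
  then have "a (Suc (Suc n)) \<noteq> 0" by auto
  moreover have "fls_subdegree (1 / y) > 0"
    using Suc.prems y by (simp add: divide_inverse)
  ultimately have "fls_subdegree ?z = - int (degree (a (Suc (Suc n))))"
    using deg by (subst fls_subdegree_add_eq1) auto
  then have z: "fls_subdegree ?z < 0" using deg by simp
  have step: "(u * ?z + v) = ((?a * u + v) * y + u) / y" for u v
    using y by (simp add: field_simps)
  have "foldr (\<lambda>q z. poly_to_fls q + 1 / z) (map a [1..<Suc (Suc (Suc n))]) y =
     foldr (\<lambda>q z. poly_to_fls q + 1 / z) (map a [1..<Suc (Suc n)]) ?z"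
    by simp
  also have "\<dots> = (?P (Suc n) * ?z + ?P n) / (?Q (Suc n) * ?z + ?Q n)"
    by (rule Suc.IH [OF z])
  also have "\<dots> = (?P (Suc (Suc n)) * y + ?P (Suc n)) / (?Q (Suc (Suc n)) * y + ?Q (Suc n))"
    unfolding step using y by (simp add: poly_to_fls.hom_add poly_to_fls.hom_mult)
  finally show ?case .
qed

definition cf_convergent :: "(nat \<Rightarrow> 'a::field poly) \<Rightarrow> nat \<Rightarrow> 'a fls" where
  "cf_convergent a n = poly_to_fls (cf_num a n) / poly_to_fls (cf_den a n)"

lemma finite_cfrac_eq_convergent:
  fixes a :: "nat \<Rightarrow> 'a::field poly"
  assumes "\<And>n. n \<ge> 1 \<Longrightarrow> degree (a n) > 0" and "n \<ge> 1"
  shows "finite_cfrac (map a [1..<Suc n]) = cf_convergent a n"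
proof -
  obtain m where n: "n = Suc m" using assms(2) by (cases n) auto
  show ?thesis
  proof (cases m)
    case 0
    then show ?thesis by (simp add: cf_convergent_def n)
  next
    case (Suc j)
    have "fls_subdegree (poly_to_fls (a n)) < 0"
      using assms by simp
    from foldr_cfrac_continuant [of a, OF assms(1) this, of j] show ?thesis
      using finite_cfrac_snoc [of "map a [1..<n]" "a n"] assms(2)
      by (simp add: cf_convergent_def n Suc poly_to_fls.hom_add poly_to_fls.hom_mult mult.commute)
  qed
qed

text \<open>Since the previous denominator has no larger degree, the product in the recurrence
  determines the degree. The sum starts at 2 because \<open>cf_den a 1 = 1\<close>.\<close>

lemma cf_den_nonzero_and_degree:
  fixes a :: "nat \<Rightarrow> 'a::field poly"
  assumes "\<And>n. n \<ge> 1 \<Longrightarrow> degree (a n) > 0"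
  shows "cf_den a (Suc n) \<noteq> 0 \<and> degree (cf_den a n) \<le> degree (cf_den a (Suc n)) \<and>
    degree (cf_den a (Suc n)) = (\<Sum>i=2..Suc n. degree (a i))"
proof (induction n)
  case (Suc n)
  have deg: "degree (a (Suc (Suc n))) > 0" using assms by simp
  then have prod: "degree (a (Suc (Suc n)) * cf_den a (Suc n)) =
      degree (a (Suc (Suc n))) + degree (cf_den a (Suc n))"
    using Suc by (intro degree_mult_eq) auto
  then have *: "degree (cf_den a (Suc (Suc n))) =
      degree (a (Suc (Suc n))) + degree (cf_den a (Suc n))"
    using deg Suc by (simp add: degree_add_eq_left)
  then have "cf_den a (Suc (Suc n)) \<noteq> 0" using deg by auto
  with * Suc show ?case by simp
qed simp

section \<open>Distances from \<alpha> to its convergents and to other fractions\<close>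

context
  fixes a :: "nat \<Rightarrow> 'a::field poly" and \<alpha> :: "'a fls"
  assumes cfrac: "has_cfrac \<alpha> a"
begin

lemma degree_partial_quotient: "n \<ge> 1 \<Longrightarrow> degree (a n) > 0"
  using cfrac by (simp add: has_cfrac_def)

lemma cf_den_nonzero: "n \<ge> 1 \<Longrightarrow> cf_den a n \<noteq> 0"
  using cf_den_nonzero_and_degree [of a, OF degree_partial_quotient, of "n - 1"] by simp

lemma degree_cf_den: "n \<ge> 1 \<Longrightarrow> degree (cf_den a n) = (\<Sum>i=2..n. degree (a i))"
  using cf_den_nonzero_and_degree [of a, OF degree_partial_quotient, of "n - 1"] by simp

lemma degree_cf_den_Suc:
  "n \<ge> 1 \<Longrightarrow> degree (cf_den a (Suc n)) = degree (cf_den a n) + degree (a (Suc n))"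
  by (simp add: degree_cf_den del: continuant.simps)

lemma degree_cf_den_less_Suc: "n \<ge> 1 \<Longrightarrow> degree (cf_den a n) < degree (cf_den a (Suc n))"
  using degree_partial_quotient [of "Suc n"] by (simp add: degree_cf_den_Suc del: continuant.simps)

text \<open>By the determinant identity the difference is 1 or -1 over the product of the two
  denominators.\<close>

lemma cf_convergent_Suc_diff:
  assumes "n \<ge> 1"
  shows "cf_convergent a (Suc n) - cf_convergent a n \<noteq> 0"
    and "fls_subdegree (cf_convergent a (Suc n) - cf_convergent a n) =
      int (degree (cf_den a n) + degree (cf_den a (Suc n)))"
proof -
  let ?Q = "poly_to_fls (cf_den a (Suc n)) * poly_to_fls (cf_den a n)"
  have nz: "poly_to_fls (cf_den a (Suc n)) \<noteq> 0" "poly_to_fls (cf_den a n) \<noteq> 0"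
    using cf_den_nonzero assms by (simp_all del: continuant.simps)
  have "cf_convergent a (Suc n) - cf_convergent a n =
      poly_to_fls (cf_num a (Suc n) * cf_den a n - cf_num a n * cf_den a (Suc n)) / ?Q"
    unfolding cf_convergent_def using nz
    by (simp add: diff_frac_eq poly_to_fls.hom_minus poly_to_fls.hom_mult del: continuant.simps)
  also have "\<dots> = (-1) ^ Suc n / ?Q"
    by (simp only: continuant_determinant poly_to_fls.hom_power poly_to_fls.hom_uminus poly_to_fls.hom_one)
  finally have eq: "cf_convergent a (Suc n) - cf_convergent a n = (-1) ^ Suc n / ?Q" .
  show "cf_convergent a (Suc n) - cf_convergent a n \<noteq> 0"
    unfolding eq using nz by simp
  show "fls_subdegree (cf_convergent a (Suc n) - cf_convergent a n) =
      int (degree (cf_den a n) + degree (cf_den a (Suc n)))"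
    unfolding eq using nz
    by (simp add: divide_inverse fls_subdegree_pow del: continuant.simps inverse_mult_distrib)
qed

text \<open>In the telescoping sum the subdegrees of consecutive differences increase strictly, so
  the first difference dominates. The third conjunct is carried along to compare each new difference
  with the first.\<close>

lemma cf_convergent_diff:
  assumes "1 \<le> n" and "n < m"
  shows "cf_convergent a m - cf_convergent a n \<noteq> 0 \<and>
    fls_subdegree (cf_convergent a m - cf_convergent a n) =
      int (degree (cf_den a n) + degree (cf_den a (Suc n))) \<and>
    degree (cf_den a (Suc n)) \<le> degree (cf_den a m)"
proof -
  have "Suc n \<le> m" using assms by simp
  then show ?thesis
  proof (induction m rule: dec_induct)
    case base
    then show ?case using cf_convergent_Suc_diff assms by (simp del: continuant.simps)
  next
    case (step m)
    have m: "1 \<le> m" using step assms by simp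
    have split: "cf_convergent a (Suc m) - cf_convergent a n =
        (cf_convergent a m - cf_convergent a n) + (cf_convergent a (Suc m) - cf_convergent a m)"
      by simp
    have less: "fls_subdegree (cf_convergent a m - cf_convergent a n) <
        fls_subdegree (cf_convergent a (Suc m) - cf_convergent a m)"
      using step degree_cf_den_less_Suc [OF m] degree_cf_den_less_Suc [OF assms(1)]
      by (simp add: cf_convergent_Suc_diff(2) [OF m] del: continuant.simps)
    have sd: "fls_subdegree (cf_convergent a (Suc m) - cf_convergent a n) =
        fls_subdegree (cf_convergent a m - cf_convergent a n)"
      unfolding split using step less by (intro fls_subdegree_add_eq1) auto
    have "fls_subdegree (cf_convergent a (Suc m) - cf_convergent a n) > 0"
      using sd step degree_cf_den_less_Suc [OF assms(1)] by (simp del: continuant.simps)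
    then have "cf_convergent a (Suc m) - cf_convergent a n \<noteq> 0" by force
    then show ?case
      using sd step degree_cf_den_less_Suc [OF m] by (simp del: continuant.simps)
  qed
qed

text \<open>A later convergent close enough to \<alpha> stands in for it: its error is smaller than
  its known distance from the \<open>n\<close>-th convergent and drops out by the ultrametric
  inequality.\<close>

lemma cfrac_minus_cf_convergent:
  assumes "n \<ge> 1"
  shows "\<alpha> - cf_convergent a n \<noteq> 0"
    and "fls_subdegree (\<alpha> - cf_convergent a n) =
      int (degree (cf_den a n) + degree (cf_den a (Suc n)))"
proof -
  define N where "N = degree (cf_den a n) + degree (cf_den a (Suc n))"
  have N: "N > 0" using degree_cf_den_less_Suc [OF assms] by (simp add: N_def del: continuant.simps)
  have "(\<lambda>n. finite_cfrac (map a [1..<Suc n])) \<longlonglongrightarrow> \<alpha>"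
    using cfrac by (simp add: has_cfrac_def)
  then have "\<forall>\<^sub>F m in sequentially. dist (finite_cfrac (map a [1..<Suc m])) \<alpha> < inverse (2 ^ N)"
    by (rule tendstoD) simp
  then obtain K where K: "\<And>m. m \<ge> K \<Longrightarrow> dist (finite_cfrac (map a [1..<Suc m])) \<alpha> < inverse (2 ^ N)"
    unfolding eventually_sequentially by blast
  define m where "m = max K (Suc n)"
  have m: "m > n" "dist (finite_cfrac (map a [1..<Suc m])) \<alpha> < inverse (2 ^ N)"
    using K [of m] by (simp_all add: m_def)
  then have "dist (cf_convergent a m) \<alpha> < inverse (2 ^ N)"
    using finite_cfrac_eq_convergent [of a, OF degree_partial_quotient, of m]
    by simp
  then have close: "\<alpha> = cf_convergent a m \<or> fls_subdegree (\<alpha> - cf_convergent a m) > int N"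
    by (rule lt_subdegree_of_dist_lt)
  have split: "\<alpha> - cf_convergent a n = (cf_convergent a m - cf_convergent a n) + (\<alpha> - cf_convergent a m)"
    by simp
  have sd: "fls_subdegree (\<alpha> - cf_convergent a n) = int N"
  proof (cases "\<alpha> = cf_convergent a m")
    case True
    then show ?thesis using cf_convergent_diff [OF assms m(1)] by (simp add: N_def del: continuant.simps)
  next
    case False
    then show ?thesis
      unfolding split using cf_convergent_diff [OF assms m(1)] close
      by (subst fls_subdegree_add_eq1) (simp_all add: N_def del: continuant.simps)
  qed
  then show "fls_subdegree (\<alpha> - cf_convergent a n) =
      int (degree (cf_den a n) + degree (cf_den a (Suc n)))"
    by (simp add: N_def)
  show "\<alpha> - cf_convergent a n \<noteq> 0" using sd N by force
qed

lemma degree_cf_den_unbounded: "n \<le> degree (cf_den a (Suc n))"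
proof (induction n)
  case (Suc n)
  then show ?case using degree_cf_den_less_Suc [of "Suc n"] by linarith
qed simp

lemma ex_degree_cf_den_interval:
  obtains n where "n \<ge> 1" "degree (cf_den a n) \<le> d" "d < degree (cf_den a (Suc n))"
proof -
  let ?S = "\<lambda>n. d < degree (cf_den a (Suc n))"
  define n where "n = (LEAST n. ?S n)"
  have "?S (Suc d)" using degree_cf_den_unbounded [of "Suc d"] by linarith
  then have n: "?S n" unfolding n_def by (rule LeastI)
  \<comment> \<open>\<open>cf_den a 1\<close> has degree 0, so the least index is positive and its
    predecessor fails the inequality.\<close>
  then have "n \<noteq> 0" by (cases n) simp_all
  moreover from this have "\<not> ?S (n - 1)"
    unfolding n_def by (intro not_less_Least) simp
  ultimately show ?thesis using that [of n] n by simp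
qed

text \<open>
  If \<open>P / Q\<close> is not the \<open>n\<close>-th convergent \<open>P\<^sub>n / Q\<^sub>n\<close>, its distance from it is at least
  \<open>1 / (\<bar>Q\<bar> \<bar>Q\<^sub>n\<bar>)\<close>, which exceeds \<open>\<bar>\<alpha> - P\<^sub>n / Q\<^sub>n\<bar> = 1 / (\<bar>Q\<^sub>n\<bar> \<bar>Q\<^sub>n\<^sub>+\<^sub>1\<bar>)\<close>; the ultrametric
  inequality makes it the distance of \<open>P / Q\<close> from \<open>\<alpha>\<close>.
\<close>

lemma cfrac_minus_fraction:
  assumes "Q \<noteq> 0"
    and n: "n \<ge> 1" "degree (cf_den a n) \<le> degree Q" "degree Q < degree (cf_den a (Suc n))"
  shows "\<alpha> - poly_to_fls P / poly_to_fls Q \<noteq> 0 \<and>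
    fls_subdegree (\<alpha> - poly_to_fls P / poly_to_fls Q) \<le>
      2 * int (degree Q) + int (degree (a (Suc n)))"
proof (cases "poly_to_fls P / poly_to_fls Q = cf_convergent a n")
  case True
  then show ?thesis
    using cfrac_minus_cf_convergent [OF n(1)] n
    by (simp add: degree_cf_den_Suc del: continuant.simps)
next
  case False
  let ?x = "poly_to_fls P / poly_to_fls Q" and ?q = "cf_den a n"
  define R where "R = cf_num a n * Q - P * ?q"
  have q: "?q \<noteq> 0" using cf_den_nonzero n(1) .
  have eq: "cf_convergent a n - ?x = poly_to_fls R / (poly_to_fls ?q * poly_to_fls Q)"
    using q assms(1)
    by (simp add: R_def cf_convergent_def diff_frac_eq poly_to_fls.hom_minus poly_to_fls.hom_mult
        del: continuant.simps)
  have R: "R \<noteq> 0"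
    using eq False by auto
  have ne: "cf_convergent a n - ?x \<noteq> 0" using False by simp
  have sd: "fls_subdegree (cf_convergent a n - ?x) \<le> int (degree ?q) + int (degree Q)"
    unfolding eq using R q assms(1)
    by (simp add: divide_inverse del: continuant.simps inverse_mult_distrib)
  have "fls_subdegree (\<alpha> - ?x) = fls_subdegree (cf_convergent a n - ?x)"
  proof -
    have split: "\<alpha> - ?x = (cf_convergent a n - ?x) + (\<alpha> - cf_convergent a n)" by simp
    have less: "fls_subdegree (cf_convergent a n - ?x) < fls_subdegree (\<alpha> - cf_convergent a n)"
      using sd n by (simp add: cfrac_minus_cf_convergent(2) del: continuant.simps)
    show ?thesis by (subst split) (rule fls_subdegree_add_eq1 [OF ne less])
  qed
  moreover have "\<alpha> \<noteq> ?x"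
  proof
    assume "\<alpha> = ?x"
    then have "fls_subdegree (cf_convergent a n - ?x) =
        int (degree (cf_den a n) + degree (cf_den a (Suc n)))"
      using cfrac_minus_cf_convergent(2) [OF n(1)] fls_subdegree_minus_sym by metis
    then show False using sd n by (simp del: continuant.simps)
  qed
  ultimately show ?thesis using sd n by (simp del: continuant.simps)
qed

text \<open>Fractions with deg Q > 0 have exponent at most 2 + \<kappa> + C / deg Q, whose last term
  vanishes in the limit; the convergents supplied by \<open>lower\<close> reach at least 2 +
  \<kappa>.\<close>

theorem irrationality_measure_cfrac:
  fixes C \<kappa> :: real
  assumes b: "b > 1" and \<kappa>: "\<kappa> \<ge> 0"
    and upper: "\<And>n. n \<ge> 1 \<Longrightarrow> real (degree (a (Suc n))) \<le> C + \<kappa> * real (\<Sum>i=2..n. degree (a i))"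
    and lower: "\<And>N. \<exists>n\<ge>N. real (degree (a (Suc n))) \<ge> \<kappa> * real (\<Sum>i=2..n. degree (a i))"
  shows "irrationality_measure b \<alpha> = ereal (2 + \<kappa>)"
proof (rule antisym)
  let ?F = "filtercomap (\<lambda>(P :: 'a poly, Q :: 'a poly). ultra_abs b (poly_to_fls Q)) at_top"
  let ?e = "\<lambda>P Q. - ln (ultra_abs b (\<alpha> - poly_to_fls P / poly_to_fls Q)) /
      ln (ultra_abs b (poly_to_fls Q))"
  let ?f = "\<lambda>(P, Q). ereal (?e P Q)"
  have exponent_le: "?e P Q \<le> 2 + \<kappa> + C / real (degree Q)" if "degree Q > 0" for P Q
  proof -
    have Q: "Q \<noteq> 0" using that by auto
    obtain n where n: "n \<ge> 1" "degree (cf_den a n) \<le> degree Q" "degree Q < degree (cf_den a (Suc n))"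
      by (rule ex_degree_cf_den_interval)
    note * = cfrac_minus_fraction [OF Q n, of P]
    have "of_int (fls_subdegree (\<alpha> - poly_to_fls P / poly_to_fls Q)) \<le>
        real_of_int (2 * int (degree Q) + int (degree (a (Suc n))))"
      using * by linarith
    also have "\<dots> \<le> 2 * real (degree Q) + (C + \<kappa> * real (degree (cf_den a n)))"
      using upper [OF n(1)] by (simp add: degree_cf_den [OF n(1)] del: continuant.simps)
    also have "\<dots> \<le> 2 * real (degree Q) + (C + \<kappa> * real (degree Q))"
      using n \<kappa> by (simp add: mult_left_mono del: continuant.simps)
    finally show ?thesis
      using that * by (subst approximation_exponent_eq [OF b Q]) (simp_all add: field_simps)
  qed
  show "irrationality_measure b \<alpha> \<le> ereal (2 + \<kappa>)"
  proof (rule ereal_le_epsilon2)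
    fix e :: real assume e: "e > 0"
    obtain M' :: nat where "C / e \<le> real M'" using real_arch_simple by blast
    \<comment> \<open>\<open>M\<close> is positive to exclude deg Q = 0, and large enough that deg Q
      >= M gives C / deg Q <= e.\<close>
    then obtain M where M: "M > 0" "C / e \<le> real M"
      by (intro that [of "Suc M'"]) simp_all
    have "?f x \<le> ereal (2 + \<kappa>) + ereal e"
      if "b ^ M \<le> (\<lambda>(P, Q). ultra_abs b (poly_to_fls Q)) x" for x
    proof -
      obtain P Q where x: "x = (P, Q)" by (cases x)
      have big: "b ^ M \<le> ultra_abs b (poly_to_fls Q)" using that x by simp
      moreover have "b ^ M > 0" using b by simp
      ultimately have Q: "Q \<noteq> 0" by (auto simp: ultra_abs_def)
      have deg: "M \<le> degree Q"
        using big b Q by (simp add: ultra_abs_poly_to_fls)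
      have "C / e \<le> real (degree Q)" using M(2) deg by linarith
      then have "C / real (degree Q) \<le> e"
        using e M(1) deg by (simp add: field_simps)
      then show ?thesis using exponent_le [of Q P] M(1) deg by (simp add: x)
    qed
    then show "irrationality_measure b \<alpha> \<le> ereal (2 + \<kappa>) + ereal e"
      unfolding irrationality_measure_def
      by (intro Limsup_bounded) (auto simp: eventually_filtercomap_at_top_linorder
          intro!: exI [of _ "b ^ M"])
  qed
  show "ereal (2 + \<kappa>) \<le> irrationality_measure b \<alpha>"
    unfolding irrationality_measure_def
  proof (rule Limsup_greatest)
    \<comment> \<open>A property \<open>S\<close> holding eventually holds for all pairs with large
      |Q|, so each supremum in the limit superior ranges over some convergent with exponent at least
      2 + \<kappa>.\<close>
    fix S assume "eventually S ?F"
    then obtain N where N: "\<And>P Q. N \<le> ultra_abs b (poly_to_fls Q) \<Longrightarrow> S (P, Q)"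
      unfolding eventually_filtercomap_at_top_linorder by force
    obtain M where M: "N < b ^ M" using real_arch_pow [OF b] by blast
    obtain n where n: "n \<ge> M + 2" "real (degree (a (Suc n))) \<ge> \<kappa> * real (\<Sum>i=2..n. degree (a i))"
      using lower by blast
    let ?P = "cf_num a n" and ?Q = "cf_den a n"
    have n1: "n \<ge> 1" using n by simp
    have deg: "M + 1 \<le> degree ?Q"
      using degree_cf_den_unbounded [of "n - 1"] n by simp
    have "N \<le> b ^ degree ?Q"
      using M power_increasing [of M "degree ?Q" b] deg b by linarith
    then have S: "S (?P, ?Q)"
      using cf_den_nonzero [OF n1] by (intro N) (simp add: ultra_abs_poly_to_fls)
    have "fls_subdegree (\<alpha> - poly_to_fls ?P / poly_to_fls ?Q) =
        2 * int (degree ?Q) + int (degree (a (Suc n)))"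
      using cfrac_minus_cf_convergent(2) [OF n1]
      by (simp add: cf_convergent_def degree_cf_den_Suc [OF n1] del: continuant.simps)
    moreover have "\<alpha> - poly_to_fls ?P / poly_to_fls ?Q \<noteq> 0"
      using cfrac_minus_cf_convergent(1) [OF n1] by (simp add: cf_convergent_def)
    ultimately have "?e ?P ?Q = (2 * real (degree ?Q) + real (degree (a (Suc n)))) / real (degree ?Q)"
      by (subst approximation_exponent_eq [OF b cf_den_nonzero [OF n1]])
        (simp_all del: continuant.simps)
    also have "\<dots> \<ge> 2 + \<kappa>"
      using n(2) deg unfolding degree_cf_den [OF n1, symmetric]
      by (simp add: field_simps del: continuant.simps)
    finally have "ereal (2 + \<kappa>) \<le> ?f (?P, ?Q)" by simp
    then show "ereal (2 + \<kappa>) \<le> (SUP x\<in>Collect S. ?f x)"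
      using S by (intro SUP_upper2 [of "(?P, ?Q)"]) auto
  qed
qed

end

subsection \<open>The degrees along the pattern\<close>

text \<open>\<open>f - f mod g\<close> is a multiple of \<open>g\<close> and has the degree of
  \<open>f\<close>, as a nonzero remainder has smaller degree.\<close>

lemma degree_poly_div:
  fixes f g :: "'a::field poly"
  assumes "g \<noteq> 0" "degree g \<le> degree f"
  shows "degree (f div g) = degree f - degree g"
proof (cases "f = 0")
  case False
  have "degree (f - f mod g) = degree f"
  proof (cases "f mod g = 0")
    case nz: False
    then have "degree (f mod g) < degree f"
      using degree_mod_less [of g f] assms by auto
    then show ?thesis
      by (metis degree_add_eq_left degree_minus diff_conv_add_uminus)
  qed simp
  then have "degree (f div g * g) = degree f"
    by (simp add: minus_mod_eq_div_mult)
  moreover have "f div g \<noteq> 0"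
    using assms False calculation by (auto simp: div_poly_eq_0_iff)
  ultimately show ?thesis
    using assms(1) by (simp add: degree_mult_eq)
qed simp

lemma degree_P_poly: "P_poly k \<noteq> (0 :: 'a::field poly)" "degree (P_poly k :: 'a poly) = 2 * k"
proof -
  have eq: "[:0, 1:] ^ 2 - 1 = ([:-1, 0, 1:] :: 'a poly)"
    by (simp add: power2_eq_square one_pCons)
  then show "P_poly k \<noteq> (0 :: 'a poly)"
    by (simp add: P_poly_def)
  show "degree (P_poly k :: 'a poly) = 2 * k"
    by (simp add: P_poly_def eq degree_power_eq)
qed

text \<open>Writing p = 2k + 1 + r avoids truncated subtraction. With T the geometric sum, p(1 + rT)
  - 2k = 1 + r(1 + pT), and 1 + pT is the next geometric sum.\<close>

lemma degree_A_poly: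
  assumes "p = 2 * k + 1 + r"
  shows "degree (A_poly p k m :: 'a::field poly) = 1 + r * (\<Sum>j<m. p ^ j)"
proof (induction m)
  case (Suc m)
  have "degree (A_poly p k m ^ p :: 'a poly) = p * (1 + r * (\<Sum>j<m. p ^ j))"
  proof -
    have "A_poly p k m \<noteq> (0 :: 'a poly)" using Suc by auto
    then show ?thesis using Suc by (simp add: degree_power_eq)
  qed
  moreover have "2 * k \<le> p * (1 + r * (\<Sum>j<m. p ^ j))"
    using assms by simp
  ultimately have "degree (A_poly p k (Suc m) :: 'a poly) = p * (1 + r * (\<Sum>j<m. p ^ j)) - 2 * k"
    by (simp add: degree_poly_div degree_P_poly)
  also have "\<dots> = 1 + r * (1 + p * (\<Sum>j<m. p ^ j))"
    using assms by (simp add: algebra_simps)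
  also have "1 + p * (\<Sum>j<m. p ^ j) = (\<Sum>j<Suc m. p ^ j)"
    by (simp add: sum.lessThan_Suc_shift sum_distrib_left del: sum.lessThan_Suc)
  finally show ?case .
qed simp

section \<open>Words and their total degrees\<close>

lemma sum_list_word_power: "sum_list (map f (word_power w n)) = n * sum_list (map f w)"
  for f :: "'a \<Rightarrow> nat"
  unfolding word_power_def by (induction n) simp_all

lemma set_word_power_subset: "set (word_power w n) \<subseteq> set w"
  unfolding word_power_def by (induction n) auto

lemma sum_list_map_concat_upt:
  "sum_list (map f (concat (map g [0..<m]))) = (\<Sum>j<m. sum_list (map f (g j)))"
  for f :: "'a \<Rightarrow> nat"
  by (induction m) simp_all

lemma V_word_Cons: "\<exists>w. V_word k m = m # w"
  by (cases m) simp_all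

lemma set_V_word_le: "i \<in> set (V_word k m) \<Longrightarrow> i \<le> m"
proof (induction m arbitrary: i rule: less_induct)
  case (less m)
  show ?case
  proof (cases m)
    case 0
    with less.prems show ?thesis by simp
  next
    case (Suc n)
    with less.prems obtain "i = Suc n \<or> (\<exists>j<Suc n. i \<in> set (word_power (V_word k j) (2 * k)))"
      by fastforce
    then show ?thesis
      using less.IH Suc set_word_power_subset by (metis less_imp_le order.trans order_refl subset_iff)
  qed
qed

lemma geometric_sum_nat: "1 + q * (\<Sum>j<m. Suc q ^ j) = Suc q ^ m"
  by (induction m) (simp_all add: algebra_simps)

text \<open>With T the geometric sum, the head letter gives 1 + rT and the remaining words, by
  strong induction, 2kT; together 1 + (p - 1)T = p^m.\<close>

lemma sum_degrees_V_word:
  assumes "p = 2 * k + 1 + r"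
  shows "sum_list (map (\<lambda>i. degree (A_poly p k i :: 'a::field poly)) (V_word k m)) = p ^ m"
proof (induction m rule: less_induct)
  case (less m)
  let ?d = "\<lambda>i. degree (A_poly p k i :: 'a poly)"
  have "sum_list (map ?d (V_word k m)) = ?d m + 2 * k * (\<Sum>j<m. p ^ j)"
  proof (cases m)
    case (Suc n)
    have "sum_list (map ?d (V_word k m)) =
        ?d m + (\<Sum>j<m. sum_list (map ?d (word_power (V_word k j) (2 * k))))"
      unfolding Suc V_word.simps using sum_list_map_concat_upt [of ?d _ "Suc n"]
      by (simp del: A_poly.simps upt_Suc sum.lessThan_Suc)
    also have "\<dots> = ?d m + (\<Sum>j<m. 2 * k * p ^ j)"
      using less by (simp add: sum_list_word_power del: A_poly.simps)
    finally show ?thesis by (simp add: sum_distrib_left)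
  qed simp
  also have "\<dots> = 1 + (2 * k + r) * (\<Sum>j<m. p ^ j)"
    unfolding degree_A_poly [OF assms] by (simp add: algebra_simps)
  also have "\<dots> = p ^ m" using geometric_sum_nat [of "2 * k + r" m] assms by simp
  finally show ?case .
qed

section \<open>Initial blocks of the pattern word\<close>

definition pattern_prefix :: "nat \<Rightarrow> nat \<Rightarrow> nat \<Rightarrow> nat list" where
  "pattern_prefix k l m = concat (map (\<lambda>j. word_power (V_word k j) l) [0..<m])"

lemma word_power_V_word_nonempty: "l \<ge> 1 \<Longrightarrow> \<exists>w. word_power (V_word k m) l = m # w"
  using V_word_Cons [of k m] by (cases l) (auto simp: word_power_def)

text \<open>Blocks are peeled off one at a time; \<open>l\<close> >= 1 makes them non-empty, as
  unfolding \<open>flat\<close> requires.\<close>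

lemma pattern_word_split:
  assumes "l \<ge> 1"
  shows "pattern_word k l =
    pattern_prefix k l m @- flat (smap (\<lambda>j. word_power (V_word k j) l) (fromN m))"
proof (induction m)
  case 0
  then show ?case by (simp add: pattern_word_def pattern_prefix_def)
next
  case (Suc m)
  let ?g = "\<lambda>j. word_power (V_word k j) l"
  have "?g m \<noteq> []" using word_power_V_word_nonempty [OF assms, of k m] by auto
  then have "flat (smap ?g (fromN m)) = ?g m @- flat (smap ?g (fromN (Suc m)))"
    by (subst siterate.code) simp
  with Suc show ?case by (simp add: pattern_prefix_def)
qed

lemma pattern_word_at_prefix:
  assumes "l \<ge> 1"
  shows "pattern_word k l !! length (pattern_prefix k l m) = m"
    and "stake (length (pattern_prefix k l m)) (pattern_word k l) = pattern_prefix k l m"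
proof -
  obtain w where "word_power (V_word k m) l = m # w"
    using word_power_V_word_nonempty [OF assms] by blast
  then have "shd (flat (smap (\<lambda>j. word_power (V_word k j) l) (fromN m))) = m"
    by simp
  then show "pattern_word k l !! length (pattern_prefix k l m) = m"
    by (subst pattern_word_split [OF assms, of k m]) (simp add: shift_snth_ge)
  show "stake (length (pattern_prefix k l m)) (pattern_word k l) = pattern_prefix k l m"
    using arg_cong [OF pattern_word_split [OF assms, of k m],
      of "stake (length (pattern_prefix k l m))"] by (simp add: stake_shift)
qed

text \<open>The blocks before the \<open>m\<close>-th repeat words \<open>V_word k j\<close> with j
  < m, whose letters are at most j, so \<open>m\<close> is not among them.\<close>

lemma length_pattern_prefix_le:
  assumes "l \<ge> 1" "pattern_word k l !! n = m"
  shows "length (pattern_prefix k l m) \<le> n"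
proof (rule ccontr)
  assume "\<not> ?thesis"
  then have less: "n < length (pattern_prefix k l m)" by simp
  then have "pattern_word k l !! n = pattern_prefix k l m ! n"
    by (subst pattern_word_split [OF assms(1), of k m]) simp
  then have "m \<in> set (pattern_prefix k l m)" using assms(2) less by (metis nth_mem)
  then obtain j where "j < m" "m \<in> set (word_power (V_word k j) l)"
    by (auto simp: pattern_prefix_def)
  then show False using set_word_power_subset set_V_word_le by fastforce
qed

text \<open>Each block has at least one letter. Hence block starts, where the degree bound is
  attained, occur arbitrarily late.\<close>

lemma le_length_pattern_prefix:
  assumes "l \<ge> 1"
  shows "m \<le> length (pattern_prefix k l m)"
proof (induction m)
  case (Suc m)
  then show ?case
    using word_power_V_word_nonempty [OF assms, of k m] by (auto simp: pattern_prefix_def)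
qed simp

lemma sum_degrees_pattern_prefix:
  assumes "p = 2 * k + 1 + r"
  shows "sum_list (map (\<lambda>i. degree (A_poly p k i :: 'a::field poly)) (pattern_prefix k l m)) =
    l * (\<Sum>j<m. p ^ j)"
  unfolding pattern_prefix_def sum_list_map_concat_upt sum_list_word_power
    sum_degrees_V_word [OF assms] by (simp add: sum_distrib_left)

lemma sum_list_map_stake: "sum_list (map f (stake n s)) = (\<Sum>i<n. f (s !! i))"
  for f :: "'a \<Rightarrow> nat"
  by (induction n) (simp_all add: stake_Suc del: stake.simps(2))

text \<open>Aligns the partial quotients from the second on with word positions counted from 0; the
  1 stands for the degree of the first one, which the denominators do not see.\<close>

lemma sum_shifted: "1 + (\<Sum>i=2..n. f (i - 1)) = (\<Sum>i<n. f i)"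
  if "n \<ge> 1" "f 0 = 1" for f :: "nat \<Rightarrow> nat"
  using that by (induction n rule: dec_induct) simp_all

subsection \<open>The irrationality measure\<close>

theorem mainTheorem1:
  fixes p k l :: nat
    and b :: real
    and as :: "'p::prime_card mod_ring poly list"
    and \<epsilon>1 \<epsilon>2 :: "'p mod_ring"
    and \<alpha> :: "'p mod_ring fls"
    and a :: "nat \<Rightarrow> 'p mod_ring poly"
    and c :: "nat \<Rightarrow> 'p mod_ring"
  assumes "p = CARD('p)" and "odd p"
    and "b > 1"
    and "1 \<le> k" and "real k < real p / 2"
    and "l \<ge> 1" and "length as = l"
    and "first_kind_expansion p k as \<epsilon>1 \<epsilon>2 \<alpha>"
    and "has_cfrac \<alpha> a"
    and "\<And>n. n \<ge> 1 \<Longrightarrow> c n \<noteq> 0"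
    and "\<And>n. n \<ge> 1 \<Longrightarrow> a n = Polynomial.smult (c n) (A_poly p k (pattern_index k l n))"
  shows "irrationality_measure b \<alpha> = ereal (2 + (real p - 2 * real k - 1) / real l)"
proof -
  \<comment> \<open>The bound k < p/2 makes this natural subtraction exact.\<close>
  define r where "r = p - 1 - 2 * k"
  have p: "p = 2 * k + 1 + r"
    using assms(5) by (simp add: r_def)
  note l = \<open>l \<ge> 1\<close>
  let ?w = "pattern_word k l"
  define d where "d i = degree (A_poly p k i :: 'p mod_ring poly)" for i
  \<comment> \<open>\<open>S n\<close> is the total degree of the first \<open>n\<close> partial
    quotients, for n >= 1 one more than the degree of the \<open>n\<close>-th denominator.\<close>
  define S where "S n = (\<Sum>i<n. d (?w !! i))" for n
  have d: "d m = 1 + r * (\<Sum>j<m. p ^ j)" for m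
    unfolding d_def by (rule degree_A_poly [OF p])
  have deg: "degree (a n) = d (?w !! (n - 1))" if "n \<ge> 1" for n
    using assms(10,11) [OF that] by (simp add: d_def pattern_index_def)
  have S_prefix: "S (length (pattern_prefix k l m)) = l * (\<Sum>j<m. p ^ j)" for m
  proof -
    have "S (length (pattern_prefix k l m)) = sum_list (map d (pattern_prefix k l m))"
      unfolding S_def sum_list_map_stake [symmetric] pattern_word_at_prefix(2) [OF l] ..
    then show ?thesis
      using sum_degrees_pattern_prefix [OF p, of l m, where 'a = "'p mod_ring"]
      by (simp add: d_def [abs_def])
  qed
  have w0: "d (?w !! 0) = 1"
    using pattern_word_at_prefix(1) [OF l, of k 0] d [of 0] by (simp add: pattern_prefix_def)
  have D: "1 + (\<Sum>i=2..n. degree (a i)) = S n" if "n \<ge> 1" for n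
  proof -
    have "(\<Sum>i=2..n. degree (a i)) = (\<Sum>i=2..n. d (?w !! (i - 1)))"
      by (intro sum.cong) (simp_all add: deg)
    then show ?thesis
      unfolding S_def using sum_shifted [of n "\<lambda>i. d (?w !! i)"] that w0 by simp
  qed
  define \<kappa> where "\<kappa> = real r / real l"
  have \<kappa>: "\<kappa> \<ge> 0" by (simp add: \<kappa>_def)
  have l_sum: "\<kappa> * real (l * x) = real (r * x)" for x
    using l by (simp add: \<kappa>_def)
  have "irrationality_measure b \<alpha> = ereal (2 + \<kappa>)"
  \<comment> \<open>In \<open>C\<close>, the 1 is the constant term of the degree of
    \<open>A_poly\<close>, and \<kappa> pays for the difference between \<open>S n\<close> and the
    degree of the denominator.\<close>
  proof (rule irrationality_measure_cfrac [OF assms(9) \<open>b > 1\<close>, where C = "1 + \<kappa>"])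
    fix n :: nat assume n: "n \<ge> 1"
    \<comment> \<open>Position \<open>n\<close>, counted from 0, carries the letter of
      \<open>a (Suc n)\<close>.\<close>
    define m where "m = ?w !! n"
    have "length (pattern_prefix k l m) \<le> n"
      using length_pattern_prefix_le [OF l m_def [symmetric]] .
    then have "S (length (pattern_prefix k l m)) \<le> S n"
      unfolding S_def by (intro sum_mono2) auto
    then have le: "l * (\<Sum>j<m. p ^ j) \<le> S n"
      unfolding S_prefix .
    have "real (degree (a (Suc n))) = 1 + \<kappa> * real (l * (\<Sum>j<m. p ^ j))"
      unfolding l_sum by (simp add: deg d flip: m_def)
    also have "\<dots> \<le> 1 + \<kappa> * real (S n)"
      using le \<kappa> by (intro add_left_mono mult_left_mono) (simp_all only: of_nat_le_iff)
    also have "\<dots> = 1 + \<kappa> + \<kappa> * real (\<Sum>i=2..n. degree (a i))"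
      by (simp add: D [OF n, symmetric] algebra_simps)
    finally show "real (degree (a (Suc n))) \<le> 1 + \<kappa> + \<kappa> * real (\<Sum>i=2..n. degree (a i))" .
  next
    fix N :: nat
    \<comment> \<open>At a block start the total degree is exactly \<open>l\<close> times the
      geometric sum, so equality holds. \<open>Suc N\<close> in place of \<open>N\<close> keeps the
      position positive, as \<open>D\<close> demands.\<close>
    let ?n = "length (pattern_prefix k l (Suc N))"
    have n: "?n \<ge> Suc N" by (rule le_length_pattern_prefix [OF l])
    have "real (degree (a (Suc ?n))) = 1 + \<kappa> * real (S ?n)"
      unfolding S_prefix l_sum by (simp add: deg d pattern_word_at_prefix(1) [OF l])
    also have "\<dots> = 1 + \<kappa> + \<kappa> * real (\<Sum>i=2..?n. degree (a i))"
      using n by (subst D [symmetric]) (simp_all add: algebra_simps)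
    finally show "\<exists>n\<ge>N. real (degree (a (Suc n))) \<ge> \<kappa> * real (\<Sum>i=2..n. degree (a i))"
      using n \<kappa> by (intro exI [of _ ?n]) auto
  qed (use \<kappa> in simp_all)
  moreover have "\<kappa> = (real p - 2 * real k - 1) / real l"
    by (simp add: \<kappa>_def p)
  ultimately show ?thesis by simp
qed

end
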